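(* Let $k\ge 1$, let $C\subset\mathbb{R}^n$ be a $k$-solid cone, and let $\Phi_t$ be a $C^{1,\alpha}$-smooth flow on $\mathbb{R}^n$ (for some $\alpha\in(0,1]$) that is strongly monotone with respect to $C$ and satisfies $D_x\Phi_t(C\setminus\{0\})\subset \mathrm{Int}\,C$ for all $x\in\mathbb{R}^n$ and $t>0$. Let $D\subset\mathbb{R}^n$ be an open bounded set such that the orbit set $O(D)=\bigcup_{x\in D}O(x)$ is bounded. Let $Q=\{x\in\mathbb{R}^n: O(x)\text{ is pseudo-ordered}\}$ and $S=\{x\in\mathbb{R}^n:\omega(x)\text{ is a singleton}\}$. Then for any $x\in D\setminus(Q\cup S)$ and any $k$-probe $P$, there exists $\varepsilon>0$ such that $B^P(x,\varepsilon)\setminus\{x\}\subset Q$.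
   Context: Cones. A closed set $C\subset\mathbb{R}^n$ is a $k$-cone if (i) $lv\in C$ for all $v\in C$, $l\in\mathbb{R}$; and (ii) $\max\{\dim W: W\subset C\text{ a linear subspace}\}=k$. It is a $k$-solid cone if moreover there is a $k$-dimensional linear subspace $W$ with $W\setminus\{0\}\subset\mathrm{Int}\,C$. (No convexity is assumed.) Write $x\sim y$ if $x-y\in C$, and $x\approx y$ if $x-y\in\mathrm{Int}\,C$. Probes. A $k$-probe is a $k$-dimensional linear subspace $P\subset\mathbb{R}^n$ with $P\setminus\{0\}\subset\mathrm{Int}\,C$. For $x\in\mathbb{R}^n$, $P_x=x+P$, and $B^P(x,\varepsilon)=P_x\cap B(x,\varepsilon)$, where $B(x,\varepsilon)$ is the $\varepsilon$-neighborhood of $x$. Flows. A flow on $\mathbb{R}^n$ is a continuous map $\Phi:\mathbb{R}\times\mathbb{R}^n\to\mathbb{R}^n$, $\Phi_t(x)=\Phi(t,x)$, with $\Phi_0=\mathrm{id}$ and $\Phi_t\circ\Phi_s=\Phi_{t+s}$. It is $C^{1,\alpha}$-smooth if $\Phi$ is a $C^1$ map on $\mathbb{R}\times\mathbb{R}^n$ with locally $\alpha$-Hölder derivative. $D_x\Phi_t$ is the derivative of $\Phi_t$ with respect to $x$ at $(t,x)$. The flow is monotone with respect to $C$ if $x\sim y$ implies $\Phi_t(x)\sim\Phi_t(y)$ for $t\ge0$; it is strongly monotone with respect to $C$ if $x\ne y$, $x\sim y$ and $t>0$ imply $\Phi_t(x)\approx\Phi_t(y)$. Orbits. $O(x)=\{\Phi_t(x):t\ge0\}$;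 $\omega(x)=\bigcap_{s\ge0}\overline{\bigcup_{t\ge s}\{\Phi_t(x)\}}$. An orbit is nontrivial if it is not a single point. A nontrivial orbit $O(x)$ is pseudo-ordered if it contains two distinct points $\Phi_{t_1}(x)\neq\Phi_{t_2}(x)$ with $\Phi_{t_1}(x)\sim\Phi_{t_2}(x)$. *)

theory Defs
  imports "HOL-Analysis.Analysis"
begin

(* The last two conjuncts say that the maximal dimension of a subspace inside C is k. *)
definition k_cone :: "nat \<Rightarrow> 'a::euclidean_space set \<Rightarrow> bool" where
  "k_cone k C \<longleftrightarrow>
     closed C \<and>
     (\<forall>v\<in>C. \<forall>l::real. l *\<^sub>R v \<in> C) \<and>
     (\<exists>W. subspace W \<and> W \<subseteq> C \<and> dim W = k) \<and>
     (\<forall>W. subspace W \<longrightarrow> W \<subseteq> C \<longrightarrow> dim W \<le> k)"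

definition k_probe :: "nat \<Rightarrow> 'a::euclidean_space set \<Rightarrow> 'a set \<Rightarrow> bool" where
  "k_probe k C P \<longleftrightarrow> subspace P \<and> dim P = k \<and> P - {0} \<subseteq> interior C"

definition k_solid_cone :: "nat \<Rightarrow> 'a::euclidean_space set \<Rightarrow> bool" where
  "k_solid_cone k C \<longleftrightarrow>
     k_cone k C \<and> (\<exists>W. subspace W \<and> dim W = k \<and> W - {0} \<subseteq> interior C)"

definition cone_related :: "'a::euclidean_space set \<Rightarrow> 'a \<Rightarrow> 'a \<Rightarrow> bool" where
  "cone_related C x y \<longleftrightarrow> x - y \<in> C"

definition cone_strongly_related :: "'a::euclidean_space set \<Rightarrow> 'a \<Rightarrow> 'a \<Rightarrow> bool" where
  "cone_strongly_related C x y \<longleftrightarrow> x - y \<in> interior C"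

definition probe_ball :: "'a::euclidean_space set \<Rightarrow> 'a \<Rightarrow> real \<Rightarrow> 'a set" where
  "probe_ball P x \<epsilon> = ((\<lambda>p. x + p) ` P) \<inter> ball x \<epsilon>"

definition is_flow :: "(real \<Rightarrow> 'a::euclidean_space \<Rightarrow> 'a) \<Rightarrow> bool" where
  "is_flow \<Phi> \<longleftrightarrow>
     continuous_on UNIV (\<lambda>(t, x). \<Phi> t x) \<and>
     \<Phi> 0 = id \<and>
     (\<forall>t s. \<Phi> t \<circ> \<Phi> s = \<Phi> (t + s))"

definition locally_holder :: "real \<Rightarrow> ('a::metric_space \<Rightarrow> 'b::metric_space) \<Rightarrow> bool" where
  "locally_holder \<alpha> f \<longleftrightarrow>
     (\<forall>p. \<exists>r>0. \<exists>L. \<forall>q\<in>ball p r. \<forall>q'\<in>ball p r.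
        dist (f q) (f q') \<le> L * dist q q' powr \<alpha>)"

(* The derivative is taken jointly in time and space, as a map into the bounded linear
   operators with the operator norm. *)
definition C1_holder_smooth :: "real \<Rightarrow> (real \<Rightarrow> 'a::euclidean_space \<Rightarrow> 'a) \<Rightarrow> bool" where
  "C1_holder_smooth \<alpha> \<Phi> \<longleftrightarrow>
     (\<exists>F' :: real \<times> 'a \<Rightarrow> (real \<times> 'a) \<Rightarrow>\<^sub>L 'a.
        (\<forall>p. ((\<lambda>(t, x). \<Phi> t x) has_derivative blinfun_apply (F' p)) (at p)) \<and>
        continuous_on UNIV F' \<and>
        locally_holder \<alpha> F')"

definition strongly_monotone ::
  "'a::euclidean_space set \<Rightarrow> (real \<Rightarrow> 'a \<Rightarrow> 'a) \<Rightarrow> bool" where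
  "strongly_monotone C \<Phi> \<longleftrightarrow>
     (\<forall>x y t. x \<noteq> y \<longrightarrow> cone_related C x y \<longrightarrow> t > 0 \<longrightarrow>
        cone_strongly_related C (\<Phi> t x) (\<Phi> t y))"

definition space_derivative ::
  "(real \<Rightarrow> 'a::euclidean_space \<Rightarrow> 'a) \<Rightarrow> real \<Rightarrow> 'a \<Rightarrow> 'a \<Rightarrow> 'a" where
  "space_derivative \<Phi> t x = frechet_derivative (\<Phi> t) (at x)"

definition forward_orbit :: "(real \<Rightarrow> 'a \<Rightarrow> 'a) \<Rightarrow> 'a \<Rightarrow> 'a set" where
  "forward_orbit \<Phi> x = {\<Phi> t x | t. t \<ge> 0}"

definition omega_limit ::
  "(real \<Rightarrow> 'a::topological_space \<Rightarrow> 'a) \<Rightarrow> 'a \<Rightarrow> 'a set" where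
  "omega_limit \<Phi> x = (\<Inter>s\<in>{0..}. closure (\<Union>t\<in>{s..}. {\<Phi> t x}))"

definition nontrivial_orbit :: "(real \<Rightarrow> 'a \<Rightarrow> 'a) \<Rightarrow> 'a \<Rightarrow> bool" where
  "nontrivial_orbit \<Phi> x \<longleftrightarrow> \<not> is_singleton (forward_orbit \<Phi> x)"

definition pseudo_ordered_orbit ::
  "'a::euclidean_space set \<Rightarrow> (real \<Rightarrow> 'a \<Rightarrow> 'a) \<Rightarrow> 'a \<Rightarrow> bool" where
  "pseudo_ordered_orbit C \<Phi> x \<longleftrightarrow>
     nontrivial_orbit \<Phi> x \<and>
     (\<exists>t1\<ge>0. \<exists>t2\<ge>0. \<Phi> t1 x \<noteq> \<Phi> t2 x \<and> cone_related C (\<Phi> t1 x) (\<Phi> t2 x))"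

definition pseudo_ordered_set ::
  "'a::euclidean_space set \<Rightarrow> (real \<Rightarrow> 'a \<Rightarrow> 'a) \<Rightarrow> 'a set" where
  "pseudo_ordered_set C \<Phi> = {x. pseudo_ordered_orbit C \<Phi> x}"

definition singleton_limit_set ::
  "(real \<Rightarrow> 'a::topological_space \<Rightarrow> 'a) \<Rightarrow> 'a set" where
  "singleton_limit_set \<Phi> = {x. is_singleton (omega_limit \<Phi> x)}"

end

theory Submission
  imports Defs
begin

text \<open>
  Write \<open>x(t) = \<Phi> t x\<close>. Two facts carry the proof. Throughout, \<open>x\<close> has an orbit that is neither
  pseudo-ordered nor convergent to a point, and \<open>y \<noteq> x\<close> satisfies \<open>y - x \<in> C\<close>, as every point
  of a probe through \<open>x\<close> does.

  The first fact (\<open>ordered_neighbours_escape\<close>) is that there is a \<open>\<delta> > 0\<close>, the same for all such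
  \<open>y\<close>, with \<open>norm (y(t) - x(t)) \<ge> \<delta>\<close> for some \<open>t \<ge> 1\<close>. Suppose that \<open>w(t) = y(t) - x(t)\<close> stays
  smaller than \<open>\<delta>\<close>. Then \<open>w\<close> follows the linearized flow along \<open>x(t)\<close> up to a small relative error,
  and it stays in \<open>C\<close>. The velocity \<open>u(t) = x'(t)\<close> is an exact solution of the linearized flow, and it
  stays outside \<open>C\<close>, because a nonzero velocity in \<open>C\<close> would make the orbit of \<open>x\<close> pseudo-ordered
  and a zero velocity would make it a point. A strongly
  positive cocycle makes vectors that remain in \<open>C\<close> grow exponentially faster than vectors that
  never enter it. Since \<open>w\<close> is bounded, \<open>u\<close> therefore decays exponentially, so that \<open>x(t)\<close> has finite
  length and converges, which was excluded.

  The domination argument (\<open>cone_combination_step\<close>, \<open>vectors_outside_cone_decay\<close>) follows a single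
  combination of the two vectors. If \<open>w + \<sigma> u \<in> C\<close>, then the image of this vector lies so deep inside \<open>C\<close> that
  \<open>w' + \<sigma> (1 + \<rho>) u'\<close> still lies in \<open>C\<close>, with a fixed \<open>\<rho> > 0\<close>. So \<open>w + \<sigma> (1 + \<rho>)^n u \<in> C\<close> after
  \<open>n\<close> steps. But \<open>u\<close> keeps a definite angle to \<open>C\<close>, hence \<open>\<sigma> (1 + \<rho>)^n norm u\<close> is at most a constant
  times \<open>norm w\<close>.

  The second fact (\<open>ordered_neighbours_pseudo_ordered\<close>) is that escape forces a pseudo-ordered orbit.
  Suppose that \<open>y\<^sub>n\<close> tends to \<open>x\<close> and that no \<open>y\<^sub>n\<close> has a pseudo-ordered orbit. Take times \<open>t\<^sub>n\<close> at which
  \<open>y\<^sub>n\<close> is at distance at least \<open>\<delta>\<close> from \<open>x\<close>, and pass to limits \<open>a\<close> of \<open>x(t\<^sub>n)\<close> and \<open>b\<close> of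
  \<open>y\<^sub>n(t\<^sub>n)\<close>. Then \<open>b \<noteq> a\<close>, and strong monotonicity gives \<open>b - a \<in> interior C\<close>. For one fixed and
  large \<open>N\<close> the point \<open>x(t\<^sub>N)\<close> is close to \<open>a\<close>, and by continuity so is \<open>y\<^sub>n(t\<^sub>N)\<close> for large \<open>n\<close>, while
  \<open>y\<^sub>n(t\<^sub>n)\<close> is close to \<open>b\<close>. So the two points \<open>y\<^sub>n(t\<^sub>n)\<close> and \<open>y\<^sub>n(t\<^sub>N)\<close> of one orbit are ordered and
  distinct, a contradiction.
\<close>

section \<open>The variational equation of a smooth flow\<close>

text \<open>
  Here \<open>A t z\<close> is the spatial derivative of \<open>\<Phi> t\<close> at \<open>z\<close>, and \<open>f\<close> is the vector field that generates
  the flow. The last assumption says that the velocity along an orbit solves the variational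
  equation, which makes it comparable with differences of nearby orbits.
\<close>

locale differentiable_flow =
  fixes \<Phi> :: "real \<Rightarrow> 'a::euclidean_space \<Rightarrow> 'a"
    and A :: "real \<Rightarrow> 'a \<Rightarrow> 'a \<Rightarrow>\<^sub>L 'a"
    and f :: "'a \<Rightarrow> 'a"
  assumes flow_zero: "\<Phi> 0 z = z"
    and flow_add: "\<Phi> (t + s) z = \<Phi> t (\<Phi> s z)"
    and flow_deriv: "(\<Phi> t has_derivative blinfun_apply (A t z)) (at z)"
    and deriv_continuous: "continuous_on UNIV (\<lambda>(t, z). A t z)"
    and flow_velocity: "((\<lambda>s. \<Phi> s z) has_vector_derivative f (\<Phi> t z)) (at t)"
    and velocity_transport: "A t z (f z) = f (\<Phi> t z)"

text \<open>
  \<open>A\<close> and \<open>f\<close> are the two partial derivatives of the jointly differentiable flow map, \<open>f\<close> taken at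
  time \<open>0\<close>. The velocity is transported by \<open>A\<close> because \<open>\<Phi> s (\<Phi> t z)\<close> and \<open>\<Phi> t (\<Phi> s z)\<close> are the same
  function of \<open>s\<close>, and their derivatives at \<open>s = 0\<close> are \<open>f (\<Phi> t z)\<close> and \<open>A t z (f z)\<close>.
\<close>

lemma C1_flow_differentiable_flow:
  assumes fl: "is_flow \<Phi>" and C1: "C1_holder_smooth \<alpha> \<Phi>"
  obtains A f where "differentiable_flow \<Phi> A f"
proof -
  obtain F' where F': "\<And>p. ((\<lambda>(t, x). \<Phi> t x) has_derivative blinfun_apply (F' p)) (at p)"
    and cont: "continuous_on UNIV F'"
    using C1 unfolding C1_holder_smooth_def by blast
  have zero: "\<Phi> 0 z = z" and add: "\<Phi> (t + s) z = \<Phi> t (\<Phi> s z)" for t s z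
    using fl unfolding is_flow_def by (auto simp: fun_eq_iff)
  define J :: "'a \<Rightarrow>\<^sub>L (real \<times> 'a)" where "J = Blinfun (\<lambda>v. (0, v))"
  have J: "blinfun_apply J v = (0, v)" for v
    unfolding J_def by (subst bounded_linear_Blinfun_apply) (auto intro: bounded_linear_intros)
  define A where "A t z = F' (t, z) o\<^sub>L J" for t z
  define f where "f z = blinfun_apply (F' (0, z)) (1, 0)" for z
  have A_deriv: "(\<Phi> t has_derivative blinfun_apply (A t z)) (at z)" for t z
  proof -
    have 1: "((\<lambda>y. (t, y)) has_derivative (\<lambda>v. (0, v))) (at z)"
      by (auto intro!: derivative_eq_intros)
    have "((\<lambda>y. (\<lambda>(t, x). \<Phi> t x) (t, y)) has_derivative
        (\<lambda>v. blinfun_apply (F' (t, z)) (0, v))) (at z)"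
      using has_derivative_compose[OF 1 F'] .
    then show ?thesis by (simp add: A_def J blinfun_compose.rep_eq comp_def)
  qed
  have time: "((\<lambda>s. \<Phi> s z) has_vector_derivative blinfun_apply (F' (t, z)) (1, 0)) (at t)" for t z
  proof -
    have 1: "((\<lambda>s. (s, z)) has_derivative (\<lambda>r. (r, 0))) (at t)"
      by (auto intro!: derivative_eq_intros)
    have "((\<lambda>s. \<Phi> s z) has_derivative (\<lambda>r. blinfun_apply (F' (t, z)) (r, 0))) (at t)"
      using has_derivative_compose[OF 1 F'] by simp
    moreover have lin: "blinfun_apply (F' (t, z)) (r, 0) = r *\<^sub>R blinfun_apply (F' (t, z)) (1, 0)" for r
      by (simp flip: blinfun.scaleR_right)
    ultimately show ?thesis
      unfolding has_vector_derivative_def by (subst lin[symmetric])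
  qed
  have velocity: "((\<lambda>s. \<Phi> s z) has_vector_derivative f (\<Phi> t z)) (at t)" for t z
  proof -
    have "((\<lambda>s. \<Phi> s (\<Phi> t z)) has_vector_derivative f (\<Phi> t z)) (at (t - t))"
      using time[of "\<Phi> t z" 0] by (simp add: f_def)
    moreover have "((\<lambda>s. s - t) has_real_derivative 1) (at t)"
      by (auto intro!: derivative_eq_intros)
    ultimately have "(((\<lambda>s. \<Phi> s (\<Phi> t z)) \<circ> (\<lambda>s. s - t)) has_vector_derivative
        1 *\<^sub>R f (\<Phi> t z)) (at t)"
      by (intro vector_diff_chain_at)
        (auto simp: has_real_derivative_iff_has_vector_derivative)
    moreover have "(\<lambda>s. \<Phi> s (\<Phi> t z)) \<circ> (\<lambda>s. s - t) = (\<lambda>s. \<Phi> s z)"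
      by (auto simp: fun_eq_iff add[symmetric])
    ultimately show ?thesis by simp
  qed
  have transport: "A t z (f z) = f (\<Phi> t z)" for t z
  proof -
    have "((\<lambda>s. \<Phi> s z) has_derivative (\<lambda>r. r *\<^sub>R f z)) (at 0)"
      using velocity[of z 0] by (simp add: zero has_vector_derivative_def)
    moreover have "(\<Phi> t has_derivative blinfun_apply (A t z)) (at (\<Phi> 0 z))"
      using A_deriv by (simp add: zero)
    ultimately have "((\<lambda>s. \<Phi> t (\<Phi> s z)) has_derivative (\<lambda>r. A t z (r *\<^sub>R f z))) (at 0)"
      by (rule has_derivative_compose)
    then have "((\<lambda>s. \<Phi> s (\<Phi> t z)) has_vector_derivative A t z (f z)) (at 0)"
      by (simp add: has_vector_derivative_def blinfun.scaleR_right add[symmetric] add.commute)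
    moreover have "((\<lambda>s. \<Phi> s (\<Phi> t z)) has_vector_derivative f (\<Phi> t z)) (at 0)"
      using velocity[of "\<Phi> t z" 0] by (simp add: zero)
    ultimately show ?thesis by (rule vector_derivative_unique_at)
  qed
  have "continuous_on UNIV (\<lambda>p. F' p o\<^sub>L J)"
    using cont by (intro continuous_intros)
  then have "continuous_on UNIV (\<lambda>(t, z). A t z)"
    by (simp add: A_def split_beta)
  then have "differentiable_flow \<Phi> A f"
    using zero add A_deriv velocity transport by unfold_locales
  then show thesis by (rule that)
qed

context differentiable_flow
begin

lemma space_derivative_eq: "space_derivative \<Phi> t z = blinfun_apply (A t z)"
  unfolding space_derivative_def using flow_deriv by (rule frechet_derivative_at[symmetric])

lemma isCont_flow: "isCont (\<Phi> t) z"
  using flow_deriv by (rule has_derivative_continuous)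

lemma deriv_continuous_space: "continuous_on K (A t)"
proof -
  have "continuous_on K (\<lambda>z. (\<lambda>(t, z). A t z) (t, z))"
    by (rule continuous_on_compose2[OF deriv_continuous]) (auto intro!: continuous_intros)
  then show ?thesis by simp
qed

lemma deriv_bounded_on_compact:
  assumes "compact K"
  obtains L where "L > 0"
    and "\<And>s z v. \<lbrakk>s \<in> {0..1}; z \<in> K\<rbrakk> \<Longrightarrow> norm (A s z v) \<le> L * norm v"
proof -
  have "compact ((\<lambda>(t, z). A t z) ` ({0..1} \<times> K))"
    by (intro compact_continuous_image continuous_on_subset[OF deriv_continuous]
        compact_Times assms) auto
  then obtain L where L: "L > 0" "\<And>s z. \<lbrakk>s \<in> {0..1}; z \<in> K\<rbrakk> \<Longrightarrow> norm (A s z) \<le> L"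
    by (force simp: bounded_pos dest: compact_imp_bounded)
  show thesis
  proof (rule that[OF L(1)])
    fix s z v assume "s \<in> {0..1::real}" "z \<in> K"
    then show "norm (A s z v) \<le> L * norm v"
      using L(2) norm_blinfun[of "A s z" v] by (meson mult_right_mono norm_ge_zero order_trans)
  qed
qed

text \<open>
  The mean value inequality for \<open>\<Phi> t - A t z\<close>, whose derivative is small near \<open>z\<close>, uniformly in
  \<open>z \<in> K\<close> because \<open>A t\<close> is uniformly continuous on a ball that contains a neighbourhood of \<open>K\<close>.
\<close>

lemma uniform_linearization:
  assumes "compact K" and "\<theta> > 0"
  obtains \<delta> where "\<delta> > 0" and
    "\<And>y z. \<lbrakk>z \<in> K; norm (y - z) < \<delta>\<rbrakk> \<Longrightarrow>
       norm (\<Phi> t y - \<Phi> t z - A t z (y - z)) \<le> \<theta> * norm (y - z)"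
proof -
  obtain R where R: "\<And>z. z \<in> K \<Longrightarrow> norm z \<le> R"
    using compact_imp_bounded[OF assms(1)] by (auto simp: bounded_iff)
  have "uniformly_continuous_on (cball 0 (R + 1)) (A t)"
    by (intro compact_uniformly_continuous deriv_continuous_space) simp
  then obtain d where d: "d > 0" and
    dA: "\<And>y z. \<lbrakk>y \<in> cball 0 (R + 1); z \<in> cball 0 (R + 1); dist y z < d\<rbrakk> \<Longrightarrow> dist (A t y) (A t z) < \<theta>"
    unfolding uniformly_continuous_on_def using \<open>\<theta> > 0\<close> by metis
  define \<delta> where "\<delta> = min d 1"
  have \<delta>: "\<delta> > 0" using d by (simp add: \<delta>_def)
  show thesis
  proof (rule that[of \<delta>])
    show "\<delta> > 0" by (rule \<delta>)
    fix y z assume z: "z \<in> K" and yz: "norm (y - z) < \<delta>"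
    have near: "norm (A t \<xi> - A t z) \<le> \<theta>" if "\<xi> \<in> ball z \<delta>" for \<xi>
    proof -
      have "norm \<xi> \<le> norm z + norm (\<xi> - z)" by (metis diff_add_cancel norm_triangle_ineq add.commute)
      then have "dist (A t \<xi>) (A t z) < \<theta>"
        using that R[OF z] by (intro dA) (auto simp: \<delta>_def dist_norm norm_minus_commute)
      then show ?thesis by (simp add: dist_norm)
    qed
    have "norm (\<Phi> t y - A t z y - (\<Phi> t z - A t z z)) \<le> \<theta> * norm (y - z)"
    proof (rule differentiable_bound[where S = "ball z \<delta>" and f = "\<lambda>y. \<Phi> t y - A t z y"
          and f' = "\<lambda>\<xi> v. (A t \<xi> - A t z) v"])
      show "((\<lambda>y. \<Phi> t y - A t z y) has_derivative (\<lambda>v. (A t \<xi> - A t z) v)) (at \<xi> within ball z \<delta>)" for \<xi>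
        by (auto intro!: derivative_eq_intros has_derivative_at_withinI[OF flow_deriv]
            simp: blinfun.diff_left)
      show "onorm (\<lambda>v. (A t \<xi> - A t z) v) \<le> \<theta>" if "\<xi> \<in> ball z \<delta>" for \<xi>
        using near[OF that] by (simp add: norm_blinfun.rep_eq)
    qed (use yz \<delta> in \<open>auto simp: dist_norm norm_minus_commute\<close>)
    then show "norm (\<Phi> t y - \<Phi> t z - A t z (y - z)) \<le> \<theta> * norm (y - z)"
      by (simp add: blinfun.diff_right algebra_simps)
  qed
qed

end

section \<open>Domination of a cone by a positive cocycle\<close>

text \<open>
  In this section \<open>\<kappa>\<close> measures how deep \<open>M\<close> maps \<open>C\<close> into itself and \<open>L\<close> bounds the norm of \<open>M\<close>. A vector
  \<open>u\<close> that is still outside \<open>C\<close> after applying \<open>M\<close> cannot be close to \<open>C\<close>: if \<open>v \<in> C\<close> were close to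
  \<open>u\<close>, then \<open>M u\<close> would lie within the margin around \<open>M v\<close>.
\<close>

lemma cone_separates:
  fixes M :: "'a::real_normed_vector \<Rightarrow>\<^sub>L 'a"
  assumes margin: "\<And>v e. \<lbrakk>v \<in> C; v \<noteq> 0; norm e < \<kappa> * norm v\<rbrakk> \<Longrightarrow> M v + e \<in> C"
    and L: "\<And>v. norm (M v) \<le> L * norm v"
    and "M u \<notin> C" and "v \<in> C" and "L > 0"
  shows "\<kappa> * norm v \<le> L * norm (u - v)"
proof (rule ccontr)
  assume "\<not> ?thesis"
  then have less: "L * norm (u - v) < \<kappa> * norm v" by simp
  with \<open>L > 0\<close> have "v \<noteq> 0"
    by (auto simp: mult_less_0_iff)
  have "norm (M (u - v)) < \<kappa> * norm v"
    using L[of "u - v"] less by simp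
  then have "M v + M (u - v) \<in> C"
    using margin \<open>v \<in> C\<close> \<open>v \<noteq> 0\<close> by blast
  with \<open>M u \<notin> C\<close> show False
    by (simp add: blinfun.diff_right)
qed

text \<open>
  Two vectors of the cone that differ by a multiple of \<open>u\<close> have comparable lengths, because \<open>u\<close>
  points away from \<open>C\<close> and from \<open>- C = C\<close>. In particular the combination cannot vanish, so its
  image has a margin.
\<close>

lemma cone_combination_comparable:
  fixes M :: "'a::real_normed_vector \<Rightarrow>\<^sub>L 'a"
  assumes margin: "\<And>v e. \<lbrakk>v \<in> C; v \<noteq> 0; norm e < \<kappa> * norm v\<rbrakk> \<Longrightarrow> M v + e \<in> C"
    and L: "\<And>v. norm (M v) \<le> L * norm v" and "L > 0"
    and homogeneous: "\<And>l v. v \<in> C \<Longrightarrow> l *\<^sub>R v \<in> C"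
    and "M u \<notin> C" and "w \<in> C" and "\<sigma> > 0" and "w + \<sigma> *\<^sub>R u \<in> C"
  shows "\<kappa> * norm (w + \<sigma> *\<^sub>R u) \<le> L * norm w" and "\<kappa> * norm w \<le> L * norm (w + \<sigma> *\<^sub>R u)"
proof -
  have out: "M (\<sigma> *\<^sub>R u) \<notin> C"
    using homogeneous[of "M (\<sigma> *\<^sub>R u)" "inverse \<sigma>"] \<open>M u \<notin> C\<close> \<open>\<sigma> > 0\<close>
    by (auto simp: blinfun.scaleR_right)
  show "\<kappa> * norm (w + \<sigma> *\<^sub>R u) \<le> L * norm w"
    using cone_separates[OF margin L out \<open>w + \<sigma> *\<^sub>R u \<in> C\<close> \<open>L > 0\<close>] by simp
  have "- w \<in> C"
    using homogeneous[OF \<open>w \<in> C\<close>, of "-1"] by simp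
  from cone_separates[OF margin L out this \<open>L > 0\<close>]
  show "\<kappa> * norm w \<le> L * norm (w + \<sigma> *\<^sub>R u)" by (simp add: add.commute)
qed

text \<open>
  The margin \<open>\<kappa> * norm q\<close> around the image of \<open>q = w + \<sigma> u\<close> is spent in thirds: one pays for the
  error \<open>w' - M w\<close>, another for enlarging the coefficient of \<open>M u\<close>, and the last keeps
  the inequality strict. The constants in the statement are the ones for which this works, given
  that \<open>norm w\<close> and \<open>\<sigma> * norm u\<close> are bounded by multiples of \<open>norm q\<close>.
\<close>

lemma cone_combination_step:
  fixes M :: "'a::real_normed_vector \<Rightarrow>\<^sub>L 'a"
  assumes margin: "\<And>v e. \<lbrakk>v \<in> C; v \<noteq> 0; norm e < \<kappa> * norm v\<rbrakk> \<Longrightarrow> M v + e \<in> C"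
    and L: "\<And>v. norm (M v) \<le> L * norm v" and "L > 0" and "\<kappa> > 0"
    and homogeneous: "\<And>l v. v \<in> C \<Longrightarrow> l *\<^sub>R v \<in> C"
    and "M u \<notin> C" and "w \<in> C" and "w \<noteq> 0" and "\<sigma> > 0" and "w + \<sigma> *\<^sub>R u \<in> C"
    and error: "norm (w' - M w) \<le> \<kappa>\<^sup>2 / (3 * L) * norm w"
  shows "w' + (\<sigma> * (1 + \<kappa>\<^sup>2 / (3 * L * (\<kappa> + L)))) *\<^sub>R M u \<in> C"
proof -
  define \<rho> where "\<rho> = \<kappa>\<^sup>2 / (3 * L * (\<kappa> + L))"
  define q where "q = w + \<sigma> *\<^sub>R u"
  define e where "e = (w' - M w) + (\<rho> * \<sigma>) *\<^sub>R M u"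
  have qw: "\<kappa> * norm q \<le> L * norm w" and wq: "\<kappa> * norm w \<le> L * norm q"
    unfolding q_def using cone_combination_comparable[OF margin L \<open>L > 0\<close> homogeneous] assms by blast+
  have "q \<noteq> 0"
    using wq \<open>w \<noteq> 0\<close> \<open>\<kappa> > 0\<close> by (auto simp: mult_le_0_iff)
  have "norm (w' - M w) \<le> \<kappa> / 3 * norm q"
  proof -
    have "\<kappa>\<^sup>2 / (3 * L) * norm w = \<kappa> / (3 * L) * (\<kappa> * norm w)" by (simp add: power2_eq_square)
    also have "\<dots> \<le> \<kappa> / (3 * L) * (L * norm q)"
      using wq \<open>\<kappa> > 0\<close> \<open>L > 0\<close> by (intro mult_left_mono) auto
    also have "\<dots> = \<kappa> / 3 * norm q" using \<open>L > 0\<close> by simp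
    finally show ?thesis using error by linarith
  qed
  moreover have "norm ((\<rho> * \<sigma>) *\<^sub>R M u) \<le> \<kappa> / 3 * norm q"
  proof -
    have "\<rho> \<ge> 0" using \<open>\<kappa> > 0\<close> \<open>L > 0\<close> by (simp add: \<rho>_def)
    have "\<sigma> * norm u = norm (q - w)" using \<open>\<sigma> > 0\<close> by (simp add: q_def)
    also have "\<dots> \<le> norm q + norm w" by (rule norm_triangle_ineq4)
    finally have "\<kappa> * (\<sigma> * norm u) \<le> \<kappa> * norm q + \<kappa> * norm w"
      using \<open>\<kappa> > 0\<close> by (simp flip: distrib_left)
    also have "\<dots> \<le> (\<kappa> + L) * norm q" using wq by (simp add: distrib_right)
    finally have u: "\<kappa> * (\<sigma> * norm u) \<le> (\<kappa> + L) * norm q" .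
    have "norm ((\<rho> * \<sigma>) *\<^sub>R M u) = \<rho> * \<sigma> * norm (M u)"
      using \<open>\<rho> \<ge> 0\<close> \<open>\<sigma> > 0\<close> by simp
    also have "\<dots> \<le> \<rho> * \<sigma> * (L * norm u)"
      using \<open>\<rho> \<ge> 0\<close> \<open>\<sigma> > 0\<close> L by (intro mult_left_mono) auto
    also have "\<dots> = \<kappa> / (3 * (\<kappa> + L)) * (\<kappa> * (\<sigma> * norm u))"
      using \<open>L > 0\<close> by (simp add: \<rho>_def power2_eq_square)
    also have "\<dots> \<le> \<kappa> / (3 * (\<kappa> + L)) * ((\<kappa> + L) * norm q)"
      using u \<open>\<kappa> > 0\<close> \<open>L > 0\<close> by (intro mult_left_mono) auto
    also have "\<dots> = \<kappa> / 3 * norm q"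
    proof -
      have "\<kappa> / (3 * d) * (d * norm q) = \<kappa> / 3 * norm q" if "d \<noteq> 0" for d
        using that by simp
      from this[of "\<kappa> + L"] show ?thesis using \<open>\<kappa> > 0\<close> \<open>L > 0\<close> by linarith
    qed
    finally show ?thesis .
  qed
  ultimately have "norm e \<le> \<kappa> / 3 * norm q + \<kappa> / 3 * norm q"
    unfolding e_def by (intro norm_triangle_le add_mono)
  also have "\<dots> < \<kappa> * norm q"
    using \<open>\<kappa> > 0\<close> \<open>q \<noteq> 0\<close> by simp
  finally have "M q + e \<in> C"
    using margin \<open>q \<noteq> 0\<close> \<open>w + \<sigma> *\<^sub>R u \<in> C\<close> q_def by blast
  moreover have "M q + e = w' + (\<sigma> * (1 + \<rho>)) *\<^sub>R M u"
    by (simp add: q_def e_def blinfun.add_right blinfun.scaleR_right algebra_simps)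
  ultimately show ?thesis by (simp add: \<rho>_def)
qed

text \<open>
  The domination estimate. The coefficient \<open>\<sigma>\<close> for which \<open>w + \<sigma> u\<close> lies in \<open>C\<close> grows geometrically,
  whereas \<open>\<sigma> * norm u\<close> is bounded by a multiple of \<open>norm w \<le> \<delta>\<close>; hence \<open>u\<close> is dominated by a
  geometric sequence.
\<close>

lemma vectors_outside_cone_decay:
  fixes M :: "nat \<Rightarrow> 'a::real_normed_vector \<Rightarrow>\<^sub>L 'a" and u w :: "nat \<Rightarrow> 'a"
  assumes margin: "\<And>n v e. \<lbrakk>v \<in> C; v \<noteq> 0; norm e < \<kappa> * norm v\<rbrakk> \<Longrightarrow> M n v + e \<in> C"
    and L: "\<And>n v. norm (M n v) \<le> L * norm v" and "L > 0" and "\<kappa> > 0"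
    and homogeneous: "\<And>l v. v \<in> C \<Longrightarrow> l *\<^sub>R v \<in> C"
    and u: "\<And>n. u (Suc n) = M n (u n)" "\<And>n. u n \<notin> C"
    and w: "\<And>n. norm (w (Suc n) - M n (w n)) \<le> \<kappa>\<^sup>2 / (3 * L) * norm (w n)"
      "\<And>n. w n \<in> C" "\<And>n. w n \<noteq> 0" "\<And>n. norm (w n) \<le> \<delta>"
    and w0: "w 0 \<in> interior C"
  shows "summable (\<lambda>n. norm (u n))"
proof -
  define r where "r = 1 + \<kappa>\<^sup>2 / (3 * L * (\<kappa> + L))"
  have "r > 1" unfolding r_def using \<open>\<kappa> > 0\<close> \<open>L > 0\<close> by simp
  obtain d where d: "d > 0" "ball (w 0) d \<subseteq> C"
    using w0 mem_interior by blast
  have "u 0 \<noteq> 0"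
  proof
    assume "u 0 = 0"
    moreover have "0 \<in> C" using homogeneous[OF w(2), of 0] by simp
    ultimately show False using u(2) by metis
  qed
  \<comment> \<open>Half the radius, so that \<open>w 0 + \<sigma> u 0\<close> lies in the open ball.\<close>
  define \<sigma> where "\<sigma> = d / (2 * norm (u 0))"
  have "\<sigma> > 0" using d \<open>u 0 \<noteq> 0\<close> by (simp add: \<sigma>_def)
  have "w 0 + \<sigma> *\<^sub>R u 0 \<in> C"
    using d \<open>u 0 \<noteq> 0\<close> by (intro subsetD[OF d(2)]) (auto simp: \<sigma>_def dist_norm)
  have in_C: "w n + (\<sigma> * r ^ n) *\<^sub>R u n \<in> C" for n
  proof (induction n)
    case 0
    then show ?case using \<open>w 0 + \<sigma> *\<^sub>R u 0 \<in> C\<close> by simp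
  next
    case (Suc n)
    have "\<sigma> * r ^ n > 0" using \<open>\<sigma> > 0\<close> \<open>r > 1\<close> by simp
    moreover have "M n (u n) \<notin> C" using u by metis
    ultimately have "w (Suc n) + (\<sigma> * r ^ n * r) *\<^sub>R M n (u n) \<in> C"
      unfolding r_def
      using cone_combination_step[OF margin L \<open>L > 0\<close> \<open>\<kappa> > 0\<close> homogeneous _ w(2,3) _ _ w(1)] Suc
      by (metis r_def)
    then show ?case by (simp add: u(1) mult_ac)
  qed
  have bound: "norm (u n) \<le> (\<kappa> + L) * \<delta> / (\<kappa> * \<sigma>) * (1 / r) ^ n" for n
  proof -
    have s: "\<sigma> * r ^ n > 0" using \<open>\<sigma> > 0\<close> \<open>r > 1\<close> by simp
    have "M n (u n) \<notin> C" using u by metis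
    then have qw: "\<kappa> * norm (w n + (\<sigma> * r ^ n) *\<^sub>R u n) \<le> L * norm (w n)"
      using cone_combination_comparable(1)[OF margin L \<open>L > 0\<close> homogeneous _ w(2) s in_C] by blast
    have "\<sigma> * r ^ n * norm (u n) = norm ((w n + (\<sigma> * r ^ n) *\<^sub>R u n) - w n)"
      using s by simp
    also have "\<dots> \<le> norm (w n + (\<sigma> * r ^ n) *\<^sub>R u n) + norm (w n)" by (rule norm_triangle_ineq4)
    finally have "\<kappa> * (\<sigma> * r ^ n * norm (u n)) \<le> \<kappa> * (norm (w n + (\<sigma> * r ^ n) *\<^sub>R u n) + norm (w n))"
      using \<open>\<kappa> > 0\<close> by (intro mult_left_mono) auto
    also have "\<dots> \<le> (\<kappa> + L) * norm (w n)" using qw by (simp add: algebra_simps)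
    also have "\<dots> \<le> (\<kappa> + L) * \<delta>" using w(4) \<open>\<kappa> > 0\<close> \<open>L > 0\<close> by (intro mult_left_mono) auto
    finally show ?thesis
      using \<open>\<kappa> > 0\<close> \<open>\<sigma> > 0\<close> \<open>r > 1\<close> by (simp add: field_simps)
  qed
  have "summable (\<lambda>n. (\<kappa> + L) * \<delta> / (\<kappa> * \<sigma>) * (1 / r) ^ n)"
    using \<open>r > 1\<close> by (intro summable_mult summable_geometric) simp
  then show ?thesis
    by (rule summable_comparison_test') (use bound in simp)
qed

section \<open>Convergence of orbits\<close>

lemma has_vector_derivative_quotient:
  assumes "(g has_vector_derivative d) (at t)"
  shows "((\<lambda>s. (g s - g t) /\<^sub>R (s - t)) \<longlongrightarrow> d) (at t)"
proof -
  have "((\<lambda>s. norm (g s - g t - (s - t) *\<^sub>R d) / norm (s - t)) \<longlongrightarrow> 0) (at t)"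
    using assms by (simp add: has_vector_derivative_def has_derivative_iff_norm)
  moreover have "eventually (\<lambda>s. norm (g s - g t - (s - t) *\<^sub>R d) / norm (s - t)
      = norm ((g s - g t) /\<^sub>R (s - t) - d)) (at t)"
  proof (rule eventually_mono[OF eventually_neq_at_within])
    fix s assume "s \<noteq> t"
    then have "(g s - g t) /\<^sub>R (s - t) - d = (g s - g t - (s - t) *\<^sub>R d) /\<^sub>R (s - t)"
      by (simp add: scaleR_diff_right)
    then show "norm (g s - g t - (s - t) *\<^sub>R d) / norm (s - t) = norm ((g s - g t) /\<^sub>R (s - t) - d)"
      by (simp add: divide_inverse_commute)
  qed
  ultimately have "((\<lambda>s. norm ((g s - g t) /\<^sub>R (s - t) - d)) \<longlongrightarrow> 0) (at t)"
    by (rule Lim_transform_eventually)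
  then show ?thesis
    by (rule LIM_zero_cancel[OF tendsto_norm_zero_cancel])
qed

lemma convergent_orbit_singleton_limit:
  fixes \<Phi> :: "real \<Rightarrow> 'a::metric_space \<Rightarrow> 'a"
  assumes lim: "((\<lambda>t. \<Phi> t x) \<longlongrightarrow> l) at_top"
  shows "x \<in> singleton_limit_set \<Phi>"
proof -
  have "l \<in> closure (\<Union>t\<in>{s..}. {\<Phi> t x})" for s
    by (intro Lim_in_closed_set[OF closed_closure _ _ lim])
      (auto intro!: eventually_mono[OF eventually_ge_at_top[of s]] subsetD[OF closure_subset])
  moreover have "y = l" if y: "y \<in> omega_limit \<Phi> x" for y
  proof (rule ccontr)
    assume "y \<noteq> l"
    define d where "d = dist y l / 2"
    have "d > 0" using \<open>y \<noteq> l\<close> by (simp add: d_def)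
    then obtain T where T: "\<And>t. t \<ge> T \<Longrightarrow> dist (\<Phi> t x) l < d"
      using tendstoD[OF lim] by (auto simp: eventually_at_top_linorder)
    have "closure (\<Union>t\<in>{max T 0..}. {\<Phi> t x}) \<subseteq> cball l d"
      using T by (intro closure_minimal) (auto simp: dist_commute less_imp_le)
    moreover have "y \<in> closure (\<Union>t\<in>{max T 0..}. {\<Phi> t x})"
      using y unfolding omega_limit_def by (rule INT_D) simp
    ultimately have "dist y l \<le> d"
      by (auto simp: dist_commute)
    then show False using \<open>d > 0\<close> by (simp add: d_def)
  qed
  ultimately have "omega_limit \<Phi> x = {l}" by (auto simp: omega_limit_def)
  then show ?thesis by (simp add: singleton_limit_set_def)
qed

context differentiable_flow
begin

lemma flow_inj: "\<Phi> t y = \<Phi> t z \<longleftrightarrow> y = z"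
  by (metis add.left_inverse flow_add flow_zero)

text \<open>
  A velocity that vanishes once vanishes at all times, being transported by the linearized flow;
  the orbit is then a single point.
\<close>

lemma zero_velocity_singleton_limit:
  assumes "f (\<Phi> t x) = 0"
  shows "x \<in> singleton_limit_set \<Phi>"
proof -
  have "((\<lambda>s. \<Phi> s x) has_derivative (\<lambda>h. 0)) (at s)" for s
  proof -
    have "f (\<Phi> s x) = A (s - t) (\<Phi> t x) (f (\<Phi> t x))"
      by (simp add: velocity_transport flip: flow_add)
    also have "\<dots> = 0" using assms by simp
    finally show ?thesis
      using flow_velocity[of x s] by (simp add: has_vector_derivative_def)
  qed
  then have "\<Phi> s x = \<Phi> 0 x" for s
    by (intro has_derivative_zero_unique[of UNIV]) auto
  then have "((\<lambda>s. \<Phi> s x) \<longlongrightarrow> x) at_top" by (simp add: flow_zero)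
  then show ?thesis by (rule convergent_orbit_singleton_limit)
qed

text \<open>
  Velocities at integer times control the velocities on the whole unit intervals that follow, since
  the linearized flow is bounded there. So summability at integer times already means that the
  orbit has finite length, and it converges.
\<close>

lemma summable_velocity_singleton_limit:
  assumes "compact K" and K: "\<And>t. t \<ge> 0 \<Longrightarrow> \<Phi> t x \<in> K"
    and sum: "summable (\<lambda>n. norm (f (\<Phi> (real n) x)))"
  shows "x \<in> singleton_limit_set \<Phi>"
proof -
  obtain L where L: "L > 0" "\<And>s z v. \<lbrakk>s \<in> {0..1}; z \<in> K\<rbrakk> \<Longrightarrow> norm (A s z v) \<le> L * norm v"
    using deriv_bounded_on_compact[OF \<open>compact K\<close>] by blast
  have step: "norm (\<Phi> (real n + s) x - \<Phi> (real n) x) \<le> L * norm (f (\<Phi> (real n) x))"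
    if s: "s \<in> {0..1}" for n s
  proof -
    have "norm (f (\<Phi> t x)) \<le> L * norm (f (\<Phi> (real n) x))" if "t \<in> {real n..real n + 1}" for t
    proof -
      have "f (\<Phi> t x) = A (t - real n) (\<Phi> (real n) x) (f (\<Phi> (real n) x))"
        by (simp add: velocity_transport flip: flow_add)
      then show ?thesis using L(2) K that by auto
    qed
    then have "onorm (\<lambda>h. h *\<^sub>R f (\<Phi> t x)) \<le> L * norm (f (\<Phi> (real n) x))"
      if "t \<in> {real n..real n + 1}" for t
      using that by (intro onorm_le) (simp add: mult.commute mult_left_mono)
    then have "norm (\<Phi> (real n + s) x - \<Phi> (real n) x)
        \<le> L * norm (f (\<Phi> (real n) x)) * norm ((real n + s) - real n)"
      using s
      by (intro differentiable_bound[where S = "{real n..real n + 1}" and f = "\<lambda>t. \<Phi> t x"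
            and f' = "\<lambda>t h. h *\<^sub>R f (\<Phi> t x)"])
        (auto intro: has_derivative_at_withinI flow_velocity[unfolded has_vector_derivative_def])
    also have "\<dots> \<le> L * norm (f (\<Phi> (real n) x)) * 1"
      using s L(1) by (intro mult_left_mono) auto
    finally show ?thesis by simp
  qed
  have "summable (\<lambda>n. \<Phi> (real (Suc n)) x - \<Phi> (real n) x)"
    using step[of 1]
    by (intro summable_comparison_test'[OF summable_mult[OF sum, of L]]) (simp add: add.commute)
  then have "convergent (\<lambda>n. \<Phi> (real n) x)"
    unfolding summable_iff_convergent sum_lessThan_telescope[of "\<lambda>n. \<Phi> (real n) x"]
    by (simp add: convergent_diff_const_right_iff)
  then obtain l where l: "(\<lambda>n. \<Phi> (real n) x) \<longlonglongrightarrow> l"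
    by (auto simp: convergent_def)
  have floor: "filterlim (\<lambda>t::real. nat \<lfloor>t\<rfloor>) sequentially at_top"
    by (intro filterlim_compose[OF filterlim_nat_sequentially] filterlim_floor_sequentially)
  have "((\<lambda>t. \<Phi> t x - \<Phi> (real (nat \<lfloor>t\<rfloor>)) x) \<longlongrightarrow> 0) at_top"
  proof (rule Lim_null_comparison)
    show "eventually (\<lambda>t. norm (\<Phi> t x - \<Phi> (real (nat \<lfloor>t\<rfloor>)) x)
        \<le> L * norm (f (\<Phi> (real (nat \<lfloor>t\<rfloor>)) x))) at_top"
    proof (rule eventually_mono[OF eventually_ge_at_top[of "0::real"]])
      fix t :: real assume "t \<ge> 0"
      then have "t - real (nat \<lfloor>t\<rfloor>) \<in> {0..1}" by simp linarith
      from step[OF this, of "nat \<lfloor>t\<rfloor>"]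
      show "norm (\<Phi> t x - \<Phi> (real (nat \<lfloor>t\<rfloor>)) x) \<le> L * norm (f (\<Phi> (real (nat \<lfloor>t\<rfloor>)) x))"
        by simp
    qed
    have "(\<lambda>n. L * norm (f (\<Phi> (real n) x))) \<longlonglongrightarrow> 0"
      using summable_LIMSEQ_zero[OF sum] by (rule tendsto_mult_right_zero)
    from filterlim_compose[OF this floor]
    show "((\<lambda>t::real. L * norm (f (\<Phi> (real (nat \<lfloor>t\<rfloor>)) x))) \<longlongrightarrow> 0) at_top" .
  qed
  then have "((\<lambda>t. \<Phi> t x) \<longlongrightarrow> l) at_top"
    by (rule Lim_transform[OF filterlim_compose[OF l floor]])
  then show ?thesis by (rule convergent_orbit_singleton_limit)
qed

end

section \<open>Flows that are strongly monotone with respect to a cone\<close>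

lemma pseudo_orderedI:
  assumes "t1 \<ge> 0" "t2 \<ge> 0" "\<Phi> t1 x \<noteq> \<Phi> t2 x" "\<Phi> t1 x - \<Phi> t2 x \<in> C"
  shows "x \<in> pseudo_ordered_set C \<Phi>"
proof -
  have "\<Phi> t1 x \<in> forward_orbit \<Phi> x" "\<Phi> t2 x \<in> forward_orbit \<Phi> x"
    using assms by (auto simp: forward_orbit_def)
  then have "nontrivial_orbit \<Phi> x"
    using assms(3) by (auto simp: nontrivial_orbit_def is_singleton_def)
  then show ?thesis
    using assms by (auto simp: pseudo_ordered_set_def pseudo_ordered_orbit_def cone_related_def)
qed

locale cone_monotone_flow = differentiable_flow \<Phi> A f
  for \<Phi> :: "real \<Rightarrow> 'a::euclidean_space \<Rightarrow> 'a" and A f +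
  fixes C :: "'a set"
  assumes closed_cone: "closed C"
    and homogeneous: "v \<in> C \<Longrightarrow> l *\<^sub>R v \<in> C"
    and monotone: "\<lbrakk>y \<noteq> z; y - z \<in> C; t > 0\<rbrakk> \<Longrightarrow> \<Phi> t y - \<Phi> t z \<in> interior C"
    and positive: "\<lbrakk>v \<in> C; v \<noteq> 0; t > 0\<rbrakk> \<Longrightarrow> A t z v \<in> interior C"
begin

text \<open>
  The images of unit vectors of the cone under \<open>A 1 z\<close> with \<open>z \<in> K\<close> form a compact subset of the
  interior of \<open>C\<close>, so they have a common distance to its complement; homogeneity extends
  this to all vectors of \<open>C\<close>.
\<close>

lemma positivity_margin:
  assumes "compact K"
  obtains \<kappa> where "\<kappa> > 0" and
    "\<And>z v e. \<lbrakk>z \<in> K; v \<in> C; v \<noteq> 0; norm e < \<kappa> * norm v\<rbrakk> \<Longrightarrow> A 1 z v + e \<in> C"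
proof -
  let ?S = "(\<lambda>(z, v). A 1 z v) ` (K \<times> (C \<inter> sphere 0 1))"
  have "continuous_on (K \<times> (C \<inter> sphere 0 1)) (\<lambda>p. A 1 (fst p) (snd p))"
    by (intro blinfun.continuous_on continuous_on_compose2[OF deriv_continuous_space[of UNIV]]
        continuous_intros) auto
  then have "compact ?S"
    using closed_cone
    by (intro compact_continuous_image compact_Times assms closed_Int_compact)
      (auto simp: split_beta)
  moreover have "?S \<subseteq> interior C" using positive by force
  ultimately obtain \<kappa> where \<kappa>: "\<kappa> > 0" "(\<Union>v\<in>?S. ball v \<kappa>) \<subseteq> interior C"
    using compact_subset_open_imp_ball_epsilon_subset[OF _ open_interior] by blast
  show thesis
  proof (rule that[OF \<kappa>(1)])
    fix z v and e :: 'a assume z: "z \<in> K" and v: "v \<in> C" "v \<noteq> 0" and e: "norm e < \<kappa> * norm v"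
    let ?v = "inverse (norm v) *\<^sub>R v" and ?e = "inverse (norm v) *\<^sub>R e"
    have "A 1 z ?v \<in> ?S" using z v homogeneous[OF v(1)] by (force simp: image_iff)
    moreover have "norm ?e < \<kappa>" using e v(2) by (simp add: field_simps)
    then have "A 1 z ?v + ?e \<in> ball (A 1 z ?v) \<kappa>" by (simp add: dist_norm)
    ultimately have "A 1 z ?v + ?e \<in> C"
      using \<kappa>(2) interior_subset by blast
    from homogeneous[OF this, of "norm v"] v(2)
    show "A 1 z v + e \<in> C"
      by (simp add: blinfun.scaleR_right scaleR_right_distrib)
  qed
qed

text \<open>
  A nonzero velocity in \<open>C\<close> is moved into the interior of \<open>C\<close> by time \<open>1\<close>. Then the difference
  quotients of the orbit, which converge to it, lie in \<open>C\<close> too, and two nearby points of the orbit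
  are ordered.
\<close>

lemma velocity_not_in_cone:
  assumes "x \<notin> pseudo_ordered_set C \<Phi>" and "x \<notin> singleton_limit_set \<Phi>" and "t \<ge> 0"
  shows "f (\<Phi> t x) \<notin> C"
proof
  assume "f (\<Phi> t x) \<in> C"
  define g where "g = f (\<Phi> (1 + t) x)"
  have nz: "f (\<Phi> s x) \<noteq> 0" for s
    using assms(2) zero_velocity_singleton_limit by blast
  have "g = A 1 (\<Phi> t x) (f (\<Phi> t x))"
    by (simp add: g_def velocity_transport flip: flow_add)
  then have "g \<in> interior C"
    using positive \<open>f (\<Phi> t x) \<in> C\<close> nz by simp
  moreover have "g \<noteq> 0" using nz by (simp add: g_def)
  ultimately have "g \<in> interior C - {0}" by simp
  moreover have "((\<lambda>s. (\<Phi> s x - \<Phi> (1 + t) x) /\<^sub>R (s - (1 + t))) \<longlongrightarrow> g) (at (1 + t))"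
    using has_vector_derivative_quotient[OF flow_velocity[of x "1 + t"]] by (simp add: g_def)
  ultimately have "eventually (\<lambda>s. (\<Phi> s x - \<Phi> (1 + t) x) /\<^sub>R (s - (1 + t)) \<in> interior C - {0}) (at (1 + t))"
    by (intro topological_tendstoD open_delete open_interior)
  then have "eventually (\<lambda>s. (\<Phi> s x - \<Phi> (1 + t) x) /\<^sub>R (s - (1 + t)) \<in> interior C - {0}) (at_right (1 + t))"
    by (rule filter_leD[OF at_le, rotated]) simp
  then have "eventually (\<lambda>s. (\<Phi> s x - \<Phi> (1 + t) x) /\<^sub>R (s - (1 + t)) \<in> interior C - {0} \<and> s > 1 + t)
      (at_right (1 + t))"
    by (intro eventually_conj eventually_at_right_less)
  then obtain s where s: "s > 1 + t" "(\<Phi> s x - \<Phi> (1 + t) x) /\<^sub>R (s - (1 + t)) \<in> interior C - {0}"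
    using eventually_happens' trivial_limit_at_right_real by blast
  then have "\<Phi> s x \<noteq> \<Phi> (1 + t) x" by auto
  moreover have "\<Phi> s x - \<Phi> (1 + t) x \<in> C"
  proof -
    have "(s - (1 + t)) *\<^sub>R ((\<Phi> s x - \<Phi> (1 + t) x) /\<^sub>R (s - (1 + t))) \<in> C"
      using s(2) interior_subset by (intro homogeneous[of "_ /\<^sub>R _"]) blast
    then show ?thesis using s(1) by simp
  qed
  ultimately have "x \<in> pseudo_ordered_set C \<Phi>"
    using s(1) \<open>t \<ge> 0\<close> by (intro pseudo_orderedI[of s "1 + t"]) auto
  with assms(1) show False by blast
qed

text \<open>
  The threshold \<open>\<delta>\<close> is the distance up to which the time-one map is linear with the
  relative error \<open>\<kappa>\<^sup>2 / (3 * L)\<close> that the domination estimate tolerates. A solution \<open>y\<close> that never gets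
  that far would force the velocity of \<open>x\<close> to be summable.
\<close>

lemma ordered_neighbours_escape:
  assumes "compact K" and K: "\<And>t. t \<ge> 0 \<Longrightarrow> \<Phi> t x \<in> K"
    and x: "x \<notin> pseudo_ordered_set C \<Phi>" "x \<notin> singleton_limit_set \<Phi>"
  obtains \<delta> where "\<delta> > 0" and
    "\<And>y. \<lbrakk>y \<noteq> x; y - x \<in> C\<rbrakk> \<Longrightarrow> \<exists>t\<ge>1. norm (\<Phi> t y - \<Phi> t x) \<ge> \<delta>"
proof -
  obtain \<kappa> where \<kappa>: "\<kappa> > 0" and
    margin: "\<And>z v e. \<lbrakk>z \<in> K; v \<in> C; v \<noteq> 0; norm e < \<kappa> * norm v\<rbrakk> \<Longrightarrow> A 1 z v + e \<in> C"
    using positivity_margin[OF \<open>compact K\<close>] by blast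
  obtain L where L: "L > 0" "\<And>s z v. \<lbrakk>s \<in> {0..1}; z \<in> K\<rbrakk> \<Longrightarrow> norm (A s z v) \<le> L * norm v"
    using deriv_bounded_on_compact[OF \<open>compact K\<close>] by blast
  have "\<kappa>\<^sup>2 / (3 * L) > 0" using \<kappa> L(1) by simp
  then obtain \<delta> where \<delta>: "\<delta> > 0" and
    linear: "\<And>y z. \<lbrakk>z \<in> K; norm (y - z) < \<delta>\<rbrakk> \<Longrightarrow>
       norm (\<Phi> 1 y - \<Phi> 1 z - A 1 z (y - z)) \<le> \<kappa>\<^sup>2 / (3 * L) * norm (y - z)"
    using uniform_linearization[OF \<open>compact K\<close>] by metis
  show thesis
  proof (rule that[OF \<delta>], rule ccontr)
    fix y assume y: "y \<noteq> x" "y - x \<in> C" and "\<not> (\<exists>t\<ge>1. norm (\<Phi> t y - \<Phi> t x) \<ge> \<delta>)"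
    then have small: "norm (\<Phi> t y - \<Phi> t x) < \<delta>" if "t \<ge> 1" for t
      using that by force
    \<comment> \<open>Time starts at \<open>1\<close>, where \<open>Y 0 - X 0\<close> has already been moved from \<open>C\<close> into its interior.\<close>
    define X where "X n = \<Phi> (real (Suc n)) x" for n
    define Y where "Y n = \<Phi> (real (Suc n)) y" for n
    have Suc: "X (Suc n) = \<Phi> 1 (X n)" "Y (Suc n) = \<Phi> 1 (Y n)" for n
      by (simp_all add: X_def Y_def flip: flow_add)
    have XK: "X n \<in> K" for n using K by (simp add: X_def)
    have int: "Y n - X n \<in> interior C" for n
      using monotone[OF y] by (simp add: X_def Y_def)
    have close: "norm (Y n - X n) < \<delta>" for n
      using small by (simp add: X_def Y_def)
    have "summable (\<lambda>n. norm (f (X n)))"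
    proof (rule vectors_outside_cone_decay[where M = "\<lambda>n. A 1 (X n)" and w = "\<lambda>n. Y n - X n"
          and \<delta> = \<delta>])
      show "f (X (Suc n)) = A 1 (X n) (f (X n))" for n
        by (simp add: Suc velocity_transport)
      show "f (X n) \<notin> C" for n
        unfolding X_def using x by (intro velocity_not_in_cone) auto
      show "norm (Y (Suc n) - X (Suc n) - A 1 (X n) (Y n - X n)) \<le> \<kappa>\<^sup>2 / (3 * L) * norm (Y n - X n)" for n
        unfolding Suc using XK close by (rule linear)
      show "Y n - X n \<noteq> 0" for n using y(1) by (simp add: X_def Y_def flow_inj)
      show "Y n - X n \<in> C" for n using int interior_subset by blast
    qed (use margin L XK \<kappa> int close homogeneous in \<open>auto intro: less_imp_le\<close>)
    then have "summable (\<lambda>n. norm (f (\<Phi> (real n) x)))"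
      unfolding X_def using summable_Suc_iff[of "\<lambda>n. norm (f (\<Phi> (real n) x))"] by simp
    then have "x \<in> singleton_limit_set \<Phi>"
      using summable_velocity_singleton_limit \<open>compact K\<close> K by blast
    with x(2) show False by blast
  qed
qed

text \<open>
  The contradiction compares one orbit with itself: \<open>Y n\<close> is near \<open>b\<close> at its own escape time and, since
  it starts close to \<open>x\<close>, near \<open>a\<close> at a fixed time \<open>\<tau>\<close>.
\<close>

lemma ordered_neighbours_pseudo_ordered:
  assumes "open D" and "x \<in> D" and bdd: "bounded (\<Union>y\<in>D. forward_orbit \<Phi> y)"
    and x: "x \<notin> pseudo_ordered_set C \<Phi>" "x \<notin> singleton_limit_set \<Phi>"
  shows "\<exists>\<epsilon>>0. \<forall>y\<in>ball x \<epsilon>. y \<noteq> x \<longrightarrow> y - x \<in> C \<longrightarrow> y \<in> pseudo_ordered_set C \<Phi>"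
proof (rule ccontr)
  assume contra: "\<not> ?thesis"
  define K where "K = closure (\<Union>y\<in>D. forward_orbit \<Phi> y)"
  have "compact K" unfolding K_def using bdd by (simp add: compact_closure)
  have K: "\<Phi> t y \<in> K" if "y \<in> D" "t \<ge> 0" for t y
    unfolding K_def using that by (intro subsetD[OF closure_subset]) (auto simp: forward_orbit_def)
  obtain \<delta> where \<delta>: "\<delta> > 0" and
    escape: "\<And>y. \<lbrakk>y \<noteq> x; y - x \<in> C\<rbrakk> \<Longrightarrow> \<exists>t\<ge>1. norm (\<Phi> t y - \<Phi> t x) \<ge> \<delta>"
    using ordered_neighbours_escape[OF \<open>compact K\<close> K[OF \<open>x \<in> D\<close>] x] by blast
  obtain r where r: "r > 0" "ball x r \<subseteq> D"
    using \<open>open D\<close> \<open>x \<in> D\<close> by (meson openE)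
  have "\<exists>y\<in>ball x (min r (inverse (real (Suc n)))). y \<noteq> x \<and> y - x \<in> C \<and> y \<notin> pseudo_ordered_set C \<Phi>" for n
    using contra r(1) by (metis inverse_positive_iff_positive min_less_iff_conj of_nat_0_less_iff zero_less_Suc)
  then obtain Y where Y: "\<And>n. Y n \<in> ball x (min r (inverse (real (Suc n))))" "\<And>n. Y n \<noteq> x"
    "\<And>n. Y n - x \<in> C" "\<And>n. Y n \<notin> pseudo_ordered_set C \<Phi>"
    by metis
  have YD: "Y n \<in> D" for n using Y(1)[of n] r(2) by auto
  have Y_lim: "Y \<longlonglongrightarrow> x"
  proof (rule metric_tendsto_imp_tendsto[OF LIMSEQ_inverse_real_of_nat])
    show "eventually (\<lambda>n. dist (Y n) x \<le> dist (inverse (real (Suc n))) 0) sequentially"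
      using Y(1) by (intro always_eventually) (auto simp: dist_commute less_imp_le)
  qed
  obtain T where T: "\<And>n. T n \<ge> 1" "\<And>n. norm (\<Phi> (T n) (Y n) - \<Phi> (T n) x) \<ge> \<delta>"
    using escape[OF Y(2,3)] by metis
  \<comment> \<open>The limits are taken one time unit before the escape: passing to the limit only keeps
    differences in \<open>C\<close>, and the remaining unit of time moves them into the interior.\<close>
  define p where "p n = (\<Phi> (T n - 1) x, \<Phi> (T n - 1) (Y n))" for n
  have "p n \<in> K \<times> K" for n
    using K \<open>x \<in> D\<close> YD T(1) by (simp add: p_def)
  then obtain ab s where s: "strict_mono s" and ab: "(p \<circ> s) \<longlonglongrightarrow> ab"
    using compact_Times[OF \<open>compact K\<close> \<open>compact K\<close>] unfolding compact_def by meson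
  obtain a' b' where "ab = (a', b')" by (cases ab)
  define a where "a = \<Phi> 1 a'"
  define b where "b = \<Phi> 1 b'"
  have lim': "(\<lambda>n. \<Phi> (T (s n) - 1) x) \<longlonglongrightarrow> a'" "(\<lambda>n. \<Phi> (T (s n) - 1) (Y (s n))) \<longlonglongrightarrow> b'"
    using tendsto_fst[OF ab] tendsto_snd[OF ab] by (simp_all add: p_def \<open>ab = (a', b')\<close> comp_def)
  have lim: "(\<lambda>n. \<Phi> (T (s n)) x) \<longlonglongrightarrow> a" "(\<lambda>n. \<Phi> (T (s n)) (Y (s n))) \<longlonglongrightarrow> b"
    using lim'[THEN isCont_tendsto_compose[OF isCont_flow[of _ 1]]]
    by (simp_all add: a_def b_def flip: flow_add)
  have "\<delta> \<le> norm (b - a)"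
    by (rule tendsto_lowerbound[OF tendsto_norm[OF tendsto_diff[OF lim(2,1)]]]) (use T(2) in auto)
  then have "a \<noteq> b" using \<delta> by auto
  then have "b' \<noteq> a'" by (auto simp: a_def b_def)
  have "b' - a' \<in> C"
  proof (rule Lim_in_closed_set[OF closed_cone _ _ tendsto_diff[OF lim'(2,1)]])
    have "\<Phi> (T n - 1) (Y n) - \<Phi> (T n - 1) x \<in> C" for n
    proof (cases "T n = 1")
      case True
      then show ?thesis using Y(3) by (simp add: flow_zero)
    next
      case False
      with T(1)[of n] have "T n - 1 > 0" by simp
      then show ?thesis using monotone[OF Y(2,3)] interior_subset by blast
    qed
    then show "eventually (\<lambda>n. \<Phi> (T (s n) - 1) (Y (s n)) - \<Phi> (T (s n) - 1) x \<in> C) sequentially"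
      by simp
  qed simp
  then have "b - a \<in> interior C"
    using monotone \<open>b' \<noteq> a'\<close> by (simp add: a_def b_def)
  moreover have "b - a \<noteq> 0" using \<open>a \<noteq> b\<close> by simp
  ultimately have "b - a \<in> interior C - {0}" by simp
  \<comment> \<open>Removing \<open>0\<close> keeps the two points of the orbit distinct; \<open>0\<close> is interior to \<open>C\<close> when \<open>C\<close> is the
    whole space.\<close>
  have open': "open (interior C - {0})" by (intro open_delete open_interior)
  have "eventually (\<lambda>n. b - \<Phi> (T (s n)) x \<in> interior C - {0}) sequentially"
    by (rule topological_tendstoD[OF tendsto_diff[OF tendsto_const lim(1)] open']) fact
  then obtain N where N: "b - \<Phi> (T (s N)) x \<in> interior C - {0}"
    by (auto simp: eventually_sequentially)
  define \<tau> where "\<tau> = T (s N)"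
  have "(\<lambda>n. \<Phi> \<tau> (Y (s n))) \<longlonglongrightarrow> \<Phi> \<tau> x"
    using LIMSEQ_subseq_LIMSEQ[OF Y_lim s] by (intro isCont_tendsto_compose[OF isCont_flow]) (simp add: comp_def)
  then have "eventually (\<lambda>n. \<Phi> (T (s n)) (Y (s n)) - \<Phi> \<tau> (Y (s n)) \<in> interior C - {0}) sequentially"
    using N by (intro topological_tendstoD[OF tendsto_diff[OF lim(2)] open']) (simp add: \<tau>_def)
  then obtain n where "\<Phi> (T (s n)) (Y (s n)) - \<Phi> \<tau> (Y (s n)) \<in> interior C - {0}"
    by (auto simp: eventually_sequentially)
  then have "Y (s n) \<in> pseudo_ordered_set C \<Phi>"
    using T(1)[of "s n"] T(1)[of "s N"] interior_subset
    by (intro pseudo_orderedI[of "T (s n)" \<tau>]) (auto simp: \<tau>_def)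
  with Y(4) show False by blast
qed

end

section \<open>Orbits through probes\<close>

theorem lemma3p1:
  fixes k :: nat
    and \<alpha> :: real
    and C D :: "(real ^ 'n) set"
    and \<Phi> :: "real \<Rightarrow> real ^ 'n \<Rightarrow> real ^ 'n"
  assumes "k \<ge> 1"
    and "k_solid_cone k C"
    and "0 < \<alpha>" and "\<alpha> \<le> 1"
    and "is_flow \<Phi>"
    and "C1_holder_smooth \<alpha> \<Phi>"
    and "strongly_monotone C \<Phi>"
    and "\<forall>x. \<forall>t>0. space_derivative \<Phi> t x ` (C - {0}) \<subseteq> interior C"
    and "open D" and "bounded D"
    and "bounded (\<Union>x\<in>D. forward_orbit \<Phi> x)"
  shows "\<forall>x \<in> D - (pseudo_ordered_set C \<Phi> \<union> singleton_limit_set \<Phi>).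
           \<forall>P. k_probe k C P \<longrightarrow>
             (\<exists>\<epsilon>>0. probe_ball P x \<epsilon> - {x} \<subseteq> pseudo_ordered_set C \<Phi>)"
proof (intro ballI allI impI)
  fix x P assume x: "x \<in> D - (pseudo_ordered_set C \<Phi> \<union> singleton_limit_set \<Phi>)" and "k_probe k C P"
  then have P: "P - {0} \<subseteq> C"
    using interior_subset by (auto simp: k_probe_def)
  obtain A f where "differentiable_flow \<Phi> A f"
    using C1_flow_differentiable_flow assms(5,6) by blast
  then interpret differentiable_flow \<Phi> A f .
  interpret cone_monotone_flow \<Phi> A f C
  proof
    show "closed C" and "\<And>v l. v \<in> C \<Longrightarrow> l *\<^sub>R v \<in> C"
      using assms(2) by (auto simp: k_solid_cone_def k_cone_def)
    show "\<And>y z t. \<lbrakk>y \<noteq> z; y - z \<in> C; t > 0\<rbrakk> \<Longrightarrow> \<Phi> t y - \<Phi> t z \<in> interior C"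
      using assms(7) by (auto simp: strongly_monotone_def cone_related_def cone_strongly_related_def)
    show "\<And>v t z. \<lbrakk>v \<in> C; v \<noteq> 0; t > 0\<rbrakk> \<Longrightarrow> A t z v \<in> interior C"
      using assms(8) by (auto simp: space_derivative_eq)
  qed
  obtain \<epsilon> where "\<epsilon> > 0" and
    \<epsilon>: "\<And>y. \<lbrakk>y \<in> ball x \<epsilon>; y \<noteq> x; y - x \<in> C\<rbrakk> \<Longrightarrow> y \<in> pseudo_ordered_set C \<Phi>"
    using ordered_neighbours_pseudo_ordered[OF \<open>open D\<close> _ assms(11)] x by blast
  have "probe_ball P x \<epsilon> - {x} \<subseteq> pseudo_ordered_set C \<Phi>"
    using P by (auto simp: probe_ball_def intro!: \<epsilon>)
  with \<open>\<epsilon> > 0\<close> show "\<exists>\<epsilon>>0. probe_ball P x \<epsilon> - {x} \<subseteq> pseudo_ordered_set C \<Phi>" by blast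
qed

end
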